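(* Let $n\ge 1$ and let $V_n$ be the set of partitions of type $B_n$ without zero-block. For $\pi\in V_n$ let $s_\pi$ be the number of singleton pairs and $a_\pi$ the number of adjacency pairs of $\pi$, and put \[ P_n(x,y)=\sum_{\pi\in V_n}x^{s_{\pi}}y^{a_{\pi}}. \] Then $P_n(x,y)=P_n(y,x)$; that is, the joint distribution of $(s_\pi,a_\pi)$ over $V_n$ is symmetric.
   Context: Let $[\pm n]=\{\pm1,\pm2,\ldots,\pm n\}$. A partition of type $B_n$ is a set partition $\pi$ of $[\pm n]$ such that for every block $B$ of $\pi$, $-B=\{-b: b\in B\}$ is also a block of $\pi$, and there is at most one block $B$ with $B=-B$; such a block is called the zero-block. $V_n$ denotes the set of type $B_n$ partitions having no zero-block. For $\pi\in V_n$, $\pm i$ (with $i\in[n]$) is a singleton pair of $\pi$ if $\{i\}$ is a block of $\pi$ (equivalently $\{i\}$ and $\{-i\}$ are blocks); $s_\pi$ is the number of such $i\in[n]$. For $j\in[n]$, $\pm(j,j+1)$ is an adjacency pair of $\pi$ if $j$ and $j+1$ lie in the same block of $\pi$, where $j+1$ is taken modulo $n$ (so $n+1$ means $1$); $a_\pi$ is the number of such $j\in[n]$. (For $n=1$ the unique partition $\{\{1\},\{-1\}\}$ has one singleton pair and one adjacency pair.) *)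

theory Defs
  imports Main "HOL-Library.Disjoint_Sets"
begin

definition pm_set :: "nat \<Rightarrow> int set" where
  "pm_set n = {i. i \<noteq> 0 \<and> \<bar>i\<bar> \<le> int n}"

definition zero_block :: "int set set \<Rightarrow> int set \<Rightarrow> bool" where
  "zero_block \<pi> B \<longleftrightarrow> B \<in> \<pi> \<and> uminus ` B = B"

definition typeB_partitions :: "nat \<Rightarrow> int set set set" where
  "typeB_partitions n =
     {\<pi>. partition_on (pm_set n) \<pi> \<and>
         (\<forall>B\<in>\<pi>. uminus ` B \<in> \<pi>) \<and>
         (\<forall>B C. zero_block \<pi> B \<longrightarrow> zero_block \<pi> C \<longrightarrow> B = C)}"

definition V :: "nat \<Rightarrow> int set set set" where
  "V n = {\<pi> \<in> typeB_partitions n. \<not> (\<exists>B. zero_block \<pi> B)}"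

definition singleton_pairs :: "nat \<Rightarrow> int set set \<Rightarrow> nat" where
  "singleton_pairs n \<pi> = card {i \<in> {1..int n}. {i} \<in> \<pi>}"

definition cyc_succ :: "nat \<Rightarrow> int \<Rightarrow> int" where
  "cyc_succ n j = (if j = int n then 1 else j + 1)"

definition adjacency_pairs :: "nat \<Rightarrow> int set set \<Rightarrow> nat" where
  "adjacency_pairs n \<pi> = card {j \<in> {1..int n}. \<exists>B\<in>\<pi>. j \<in> B \<and> cyc_succ n j \<in> B}"

text \<open>
  The bivariate polynomial is given by its values in an arbitrary commutative semiring.
  As the semiring may itself be a polynomial ring with \<open>x\<close> and \<open>y\<close> its indeterminates,
  an identity between these values that holds in every commutative semiring is the
  corresponding identity of formal polynomials.
\<close>

definition P :: "nat \<Rightarrow> 'a::comm_semiring_1 \<Rightarrow> 'a \<Rightarrow> 'a" where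
  "P n x y = (\<Sum>\<pi>\<in>V n. x ^ singleton_pairs n \<pi> * y ^ adjacency_pairs n \<pi>)"

text \<open>\<open>V n\<close> is finite, so neither the sum above nor cardinalities of subsets of \<open>V n\<close> degenerate.\<close>

lemma finite_V: "finite (V n)"
proof -
  have "finite (pm_set n)"
    by (rule finite_subset[of _ "{- int n..int n}"]) (auto simp: pm_set_def)
  moreover have "V n \<subseteq> Pow (Pow (pm_set n))"
    by (auto simp: V_def typeB_partitions_def partition_on_def)
  ultimately show ?thesis
    by (meson finite_Pow_iff finite_subset)
qed

end

theory Submission
  imports Defs
begin

text \<open>
  For sets \<open>S\<close> of vertices and \<open>A\<close> of edges of the cycle on \<open>{1..n}\<close>, count the partitions in
  which every \<open>i \<in> S\<close> is a singleton and every \<open>j \<in> A\<close> is an adjacency, other singletons and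
  adjacencies being allowed. For \<open>n \<ge> 2\<close> there are none if an edge of \<open>A\<close> meets \<open>S\<close>; otherwise
  deleting \<open>S\<close> and contracting \<open>A\<close> leaves an arbitrary partition of a set of \<open>n - |S| - |A|\<close> pairs
  (if \<open>A\<close> is the whole cycle, one pair remains instead of none, but both counts are 1). This
  is invariant under exchanging vertices and edges of the cycle, and by inclusion-exclusion so is
  the number of partitions with prescribed sets of singletons and adjacencies.
\<close>

section \<open>Inclusion-exclusion: equidistribution from superset counts\<close>

text \<open>The elements with \<open>T \<subseteq> f r\<close> split into those with
  \<open>f r = T\<close> and those with a strictly larger value. Descending from \<open>U\<close>,
  the induction makes all larger fibres agree; cancelling them from the superset counts leaves the
  fibres over \<open>T\<close>. No alternating signs arise.\<close>

lemma card_fibre_eq_if_card_supersets_eq: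
  assumes "finite R" "finite U" "\<And>r. r \<in> R \<Longrightarrow> f r \<subseteq> U" "\<And>r. r \<in> R \<Longrightarrow> g r \<subseteq> U"
    and sup: "\<And>T. T \<subseteq> U \<Longrightarrow> card {r \<in> R. T \<subseteq> f r} = card {r \<in> R. T \<subseteq> g r}"
    and "T \<subseteq> U"
  shows "card {r \<in> R. f r = T} = card {r \<in> R. g r = T}"
  using \<open>T \<subseteq> U\<close>
proof (induction "card (U - T)" arbitrary: T rule: less_induct)
  case less
  have split: "card {r \<in> R. T \<subseteq> k r} =
      card {r \<in> R. k r = T} + (\<Sum>T' \<in> {T'. T \<subset> T' \<and> T' \<subseteq> U}. card {r \<in> R. k r = T'})"
    if k: "\<And>r. r \<in> R \<Longrightarrow> k r \<subseteq> U" for k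
  proof -
    have fin: "finite {T'. T \<subset> T' \<and> T' \<subseteq> U}"
      using \<open>finite U\<close> by (auto intro: finite_subset[of _ "Pow U"])
    have "{r \<in> R. T \<subseteq> k r} =
        {r \<in> R. k r = T} \<union> (\<Union>T' \<in> {T'. T \<subset> T' \<and> T' \<subseteq> U}. {r \<in> R. k r = T'})"
      using k by auto
    also have "card \<dots> = card {r \<in> R. k r = T} +
        card (\<Union>T' \<in> {T'. T \<subset> T' \<and> T' \<subseteq> U}. {r \<in> R. k r = T'})"
      using \<open>finite R\<close> fin by (intro card_Un_disjoint) auto
    also have "card (\<Union>T' \<in> {T'. T \<subset> T' \<and> T' \<subseteq> U}. {r \<in> R. k r = T'}) =
        (\<Sum>T' \<in> {T'. T \<subset> T' \<and> T' \<subseteq> U}. card {r \<in> R. k r = T'})"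
      using \<open>finite R\<close> fin by (intro card_UN_disjoint) auto
    finally show ?thesis .
  qed
  have "(\<Sum>T' \<in> {T'. T \<subset> T' \<and> T' \<subseteq> U}. card {r \<in> R. f r = T'}) =
      (\<Sum>T' \<in> {T'. T \<subset> T' \<and> T' \<subseteq> U}. card {r \<in> R. g r = T'})"
  proof (rule sum.cong)
    fix T' assume T': "T' \<in> {T'. T \<subset> T' \<and> T' \<subseteq> U}"
    then have "U - T' \<subset> U - T" by auto
    then have "card (U - T') < card (U - T)"
      using \<open>finite U\<close> by (intro psubset_card_mono) auto
    then show "card {r \<in> R. f r = T'} = card {r \<in> R. g r = T'}"
      using less.hyps T' by auto
  qed simp
  with split[of f] split[of g] sup[OF less.prems] assms(3,4) show ?case by simp
qed

text \<open>Grouped by the value of the statistic, the sum depends only on the fibre sizes.\<close>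

lemma sum_eq_if_card_supersets_eq:
  fixes h :: "'b set \<Rightarrow> 'c::comm_semiring_1"
  assumes "finite R" "finite U" "\<And>r. r \<in> R \<Longrightarrow> f r \<subseteq> U" "\<And>r. r \<in> R \<Longrightarrow> g r \<subseteq> U"
    and "\<And>T. T \<subseteq> U \<Longrightarrow> card {r \<in> R. T \<subseteq> f r} = card {r \<in> R. T \<subseteq> g r}"
  shows "(\<Sum>r\<in>R. h (f r)) = (\<Sum>r\<in>R. h (g r))"
proof -
  have *: "(\<Sum>r\<in>R. h (k r)) = (\<Sum>T\<in>Pow U. of_nat (card {r \<in> R. k r = T}) * h T)"
    if "\<And>r. r \<in> R \<Longrightarrow> k r \<subseteq> U" for k
  proof -
    have "(\<Sum>r\<in>R. h (k r)) = (\<Sum>T\<in>Pow U. \<Sum>r\<in>{r \<in> R. k r = T}. h (k r))"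
      using assms(1,2) that by (intro sum.group[symmetric]) auto
    then show ?thesis by simp
  qed
  have "card {r \<in> R. f r = T} = card {r \<in> R. g r = T}" if "T \<subseteq> U" for T
    by (rule card_fibre_eq_if_card_supersets_eq[OF assms that])
  then show ?thesis
    using *[of f] *[of g] assms(3,4) by simp
qed

section \<open>Partitions without zero-block as equivalence relations invariant under
  negation\<close>

definition pm :: "int set \<Rightarrow> int set" where
  "pm X = X \<union> uminus ` X"

text \<open>Encodes a partition by its same-block relation, on an arbitrary ground set so that
  elements can be deleted and contracted. Given invariance under negation, a block containing both
  \<open>a\<close> and \<open>- a\<close> equals its negative, so the last condition says exactly
  that there is no zero-block.\<close>

definition signed_equivs :: "int set \<Rightarrow> int rel set" where
  "signed_equivs X = {r. equiv (pm X) r \<and> (\<forall>a b. (a, b) \<in> r \<longrightarrow> (- a, - b) \<in> r) \<and> (\<forall>a. (a, - a) \<notin> r)}"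

lemma uminus_mem_pm_iff [simp]: "- a \<in> pm X \<longleftrightarrow> a \<in> pm X"
proof -
  have "b \<in> uminus ` X \<longleftrightarrow> - b \<in> X" for b :: int
    by (metis imageE image_eqI minus_minus)
  then show ?thesis by (auto simp: pm_def)
qed

lemma signed_equivsI:
  assumes "r \<subseteq> pm X \<times> pm X" "\<And>a. a \<in> pm X \<Longrightarrow> (a, a) \<in> r"
    "\<And>a b. (a, b) \<in> r \<Longrightarrow> (b, a) \<in> r"
    "\<And>a b c. (a, b) \<in> r \<Longrightarrow> (b, c) \<in> r \<Longrightarrow> (a, c) \<in> r"
    "\<And>a b. (a, b) \<in> r \<Longrightarrow> (- a, - b) \<in> r"
    "\<And>a. (a, - a) \<notin> r"
  shows "r \<in> signed_equivs X"
proof -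
  have "equiv (pm X) r"
  proof (rule equivI)
    show "refl_on (pm X) r" using assms(2) by (simp add: refl_onI)
    show "sym r" using assms(3) by (simp add: symI)
    show "trans r" using assms(4) by (blast intro: transI)
  qed (use assms(1) in simp)
  then show ?thesis using assms(5,6) by (simp add: signed_equivs_def)
qed

lemma signed_equivsD:
  assumes "r \<in> signed_equivs X"
  shows "\<And>a b. (a, b) \<in> r \<Longrightarrow> a \<in> pm X" "\<And>a b. (a, b) \<in> r \<Longrightarrow> b \<in> pm X"
    "\<And>a. a \<in> pm X \<Longrightarrow> (a, a) \<in> r"
    "\<And>a b. (a, b) \<in> r \<Longrightarrow> (b, a) \<in> r"
    "\<And>a b c. (a, b) \<in> r \<Longrightarrow> (b, c) \<in> r \<Longrightarrow> (a, c) \<in> r"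
    "\<And>a b. (a, b) \<in> r \<Longrightarrow> (- a, - b) \<in> r"
    "\<And>a. (a, - a) \<notin> r"
proof -
  have r: "r \<subseteq> pm X \<times> pm X" "refl_on (pm X) r" "sym r" "trans r"
    using assms by (auto simp: signed_equivs_def equiv_def)
  show "\<And>a b. (a, b) \<in> r \<Longrightarrow> a \<in> pm X" "\<And>a b. (a, b) \<in> r \<Longrightarrow> b \<in> pm X"
    using r(1) by auto
  show "\<And>a. a \<in> pm X \<Longrightarrow> (a, a) \<in> r" using r(2) by (simp add: refl_onD)
  show "\<And>a b. (a, b) \<in> r \<Longrightarrow> (b, a) \<in> r" using r(3) by (simp add: symD)
  show "\<And>a b c. (a, b) \<in> r \<Longrightarrow> (b, c) \<in> r \<Longrightarrow> (a, c) \<in> r"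
    using r(4) by (blast dest: transD)
  show "\<And>a b. (a, b) \<in> r \<Longrightarrow> (- a, - b) \<in> r" "\<And>a. (a, - a) \<notin> r"
    using assms by (auto simp: signed_equivs_def)
qed

lemma finite_signed_equivs: "finite X \<Longrightarrow> finite (signed_equivs X)"
proof (rule finite_subset)
  show "signed_equivs X \<subseteq> Pow (pm X \<times> pm X)"
    using signed_equivsD(1,2) by (intro subsetI PowI) auto
qed (simp add: pm_def)

section \<open>Contraction and deletion of elements\<close>

text \<open>Relations on \<open>Y\<close> pull back along the odd extension of \<open>H\<close>.\<close>

lemma card_signed_equivs_containing_kernel:
  assumes pos: "\<And>a. a \<in> X \<Longrightarrow> a > 0" and posY: "\<And>a. a \<in> Y \<Longrightarrow> a > 0"
    and H: "H ` X = Y"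
  shows "card {r \<in> signed_equivs X. \<forall>a\<in>X. \<forall>b\<in>X. H a = H b \<longrightarrow> (a, b) \<in> r} = card (signed_equivs Y)"
proof -
  define h where "h a = sgn a * H \<bar>a\<bar>" for a
  define pull where "pull r = {(a, b). a \<in> pm X \<and> b \<in> pm X \<and> (h a, h b) \<in> r}" for r
  define push where "push r = {(h a, h b) | a b. (a, b) \<in> r}" for r
  let ?K = "{r \<in> signed_equivs X. \<forall>a\<in>X. \<forall>b\<in>X. H a = H b \<longrightarrow> (a, b) \<in> r}"
  have odd: "h (- a) = - h a" for a by (simp add: h_def)
  have h_pos: "h a = H a" "h (- a) = - H a" if "a \<in> X" for a
    using pos[OF that] by (auto simp: h_def)
  have h_mem: "h a \<in> pm Y" if "a \<in> pm X" for a
    using that H h_pos by (auto simp: pm_def)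
  have h_surj: "\<exists>a\<in>pm X. h a = c" if "c \<in> pm Y" for c
  proof -
    have "c \<in> H ` X \<or> - c \<in> H ` X" using that H by (auto simp: pm_def)
    then obtain a where "a \<in> X" "c = H a \<or> c = - H a" by force
    then have "c = h a \<or> c = h (- a)" "a \<in> pm X" by (auto simp: h_pos pm_def)
    then show ?thesis by force
  qed
  have HX: "H a > 0" if "a \<in> X" for a using posY H that by auto
  \<comment> \<open>Membership in \<open>?K\<close> speaks of positive elements only. As
    \<open>H\<close> is positive on \<open>X\<close>, equal values of \<open>h\<close> force equal
    signs, and the negative case follows from invariance under negation.\<close>
  have ker: "(a, b) \<in> r" if r: "r \<in> ?K" and ab: "a \<in> pm X" "b \<in> pm X" "h a = h b" for r a b
  proof -
    have "a \<in> X \<and> h a > 0 \<or> - a \<in> X \<and> h a < 0" if "a \<in> pm X" for a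
      using that HX by (auto simp: pm_def h_pos)
    from this[OF ab(1)] this[OF ab(2)] consider "a \<in> X" "b \<in> X" | "- a \<in> X" "- b \<in> X"
      using ab(3) by force
    then show ?thesis
    proof cases
      case 1
      then show ?thesis using r ab h_pos by auto
    next
      case 2
      then have "H (- a) = H (- b)" using ab odd h_pos by metis
      then have "(- a, - b) \<in> r" using 2 r by auto
      then show ?thesis using r signed_equivsD(6)[of r X "- a" "- b"] by auto
    qed
  qed
  \<comment> \<open>\<open>push\<close> undoes \<open>pull\<close> because \<open>h\<close> maps
    onto \<open>pm Y\<close>; \<open>pull\<close> undoes \<open>push\<close> because
    \<open>r\<close> contains the kernel of \<open>h\<close>.\<close>
  have "bij_betw pull (signed_equivs Y) ?K"
  proof (rule bij_betw_byWitness[where f' = push])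
    show "\<forall>r\<in>signed_equivs Y. push (pull r) = r"
    proof
      fix r assume r: "r \<in> signed_equivs Y"
      have "(c, d) \<in> push (pull r)" if cd: "(c, d) \<in> r" for c d
      proof -
        obtain a b where "a \<in> pm X" "h a = c" "b \<in> pm X" "h b = d"
          using h_surj signed_equivsD(1,2)[OF r cd] by blast
        then have "(a, b) \<in> pull r" using cd by (simp add: pull_def)
        then show ?thesis using \<open>h a = c\<close> \<open>h b = d\<close> unfolding push_def by blast
      qed
      then show "push (pull r) = r" by (auto simp: push_def pull_def)
    qed
    show "\<forall>r\<in>?K. pull (push r) = r"
    proof
      fix r assume r: "r \<in> ?K"
      then have r': "r \<in> signed_equivs X" by simp
      have "(a, b) \<in> r" if ab: "(a, b) \<in> pull (push r)" for a b
      proof -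
        obtain a' b' where "(a', b') \<in> r" "h a' = h a" "h b' = h b" "a \<in> pm X" "b \<in> pm X"
          using ab unfolding pull_def push_def by (auto dest: sym)
        moreover from this have "(a, a') \<in> r" "(b', b) \<in> r"
          using ker[OF r] signed_equivsD(1,2)[OF r'] by metis+
        ultimately show ?thesis
          using signed_equivsD(5)[OF r'] by blast
      qed
      then show "pull (push r) = r"
        using signed_equivsD(1,2)[OF r'] unfolding pull_def push_def by blast
    qed
    show "pull ` signed_equivs Y \<subseteq> ?K"
    proof clarify
      fix r assume r: "r \<in> signed_equivs Y"
      note D = signed_equivsD[OF r]
      have "pull r \<in> signed_equivs X"
      proof (rule signed_equivsI)
        show "(a, c) \<in> pull r" if "(a, b) \<in> pull r" "(b, c) \<in> pull r" for a b c
          using that D(5) by (auto simp: pull_def)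
        show "(b, a) \<in> pull r" if "(a, b) \<in> pull r" for a b
          using that D(4) by (auto simp: pull_def)
        show "(- a, - b) \<in> pull r" if "(a, b) \<in> pull r" for a b
          using that D(6) by (auto simp: pull_def odd)
        show "(a, a) \<in> pull r" if "a \<in> pm X" for a
          using that D(3) h_mem by (simp add: pull_def)
        show "(a, - a) \<notin> pull r" for a
          using D(7) by (simp add: pull_def odd)
      qed (auto simp: pull_def)
      moreover have "(a, b) \<in> pull r" if "a \<in> X" "b \<in> X" "H a = H b" for a b
      proof -
        have "a \<in> pm X" "b \<in> pm X" "h a = h b" using that h_pos(1) by (auto simp: pm_def)
        then show ?thesis using D(3) h_mem by (simp add: pull_def)
      qed
      ultimately show "pull r \<in> signed_equivs X \<and> (\<forall>a\<in>X. \<forall>b\<in>X. H a = H b \<longrightarrow> (a, b) \<in> pull r)"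
        by blast
    qed
    show "push ` ?K \<subseteq> signed_equivs Y"
    proof
      fix q assume "q \<in> push ` ?K"
      then obtain r where r: "r \<in> ?K" and q: "q = push r" by blast
      then have r': "r \<in> signed_equivs X" by simp
      note D = signed_equivsD[OF r']
      have pushE: "\<exists>a b. (a, b) \<in> r \<and> c = h a \<and> d = h b" if "(c, d) \<in> q" for c d
        using that unfolding q push_def by blast
      have pushI: "(h a, h b) \<in> q" if "(a, b) \<in> r" for a b
        using that unfolding q push_def by blast
      show "q \<in> signed_equivs Y"
      proof (rule signed_equivsI)
        show "q \<subseteq> pm Y \<times> pm Y" using D(1,2) h_mem unfolding q push_def by blast
        show "(c, c) \<in> q" if "c \<in> pm Y" for c
          using h_surj[OF that] D(3) pushI by blast
        show "(d, c) \<in> q" if "(c, d) \<in> q" for c d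
          using pushE[OF that] D(4) pushI by blast
        show "(- c, - d) \<in> q" if cd: "(c, d) \<in> q" for c d
        proof -
          obtain a b where "(a, b) \<in> r" "c = h a" "d = h b" using pushE[OF cd] by blast
          then show ?thesis using pushI[OF D(6), of a b] by (simp add: odd)
        qed
        show "(c, e) \<in> q" if cd: "(c, d) \<in> q" and de: "(d, e) \<in> q" for c d e
        proof -
          obtain a b where ab: "(a, b) \<in> r" "c = h a" "d = h b" using pushE[OF cd] by blast
          obtain b' a' where ba: "(b', a') \<in> r" "d = h b'" "e = h a'" using pushE[OF de] by blast
          \<comment> \<open>The middle element \<open>d\<close> may have two different preimages;
            the kernel joins them.\<close>
          have "(b, b') \<in> r"
            using ker[OF r D(2)[OF ab(1)] D(1)[OF ba(1)]] ab ba by simp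
          then have "(a, a') \<in> r" using D(5) ab(1) ba(1) by blast
          then show ?thesis using pushI ab ba by simp
        qed
        show "(c, - c) \<notin> q" for c
        proof
          assume "(c, - c) \<in> q"
          then obtain a b where ab: "(a, b) \<in> r" "c = h a" "- c = h b" using pushE by blast
          \<comment> \<open>Here \<open>h b = h (- a)\<close>, so the kernel would put
            \<open>a\<close> and \<open>- a\<close> into one class.\<close>
          then have "(b, - a) \<in> r"
            using ker[OF r D(2)[OF ab(1)], of "- a"] D(1)[OF ab(1)] by (simp add: odd)
          then show False using D(5,7) ab(1) by blast
        qed
      qed
    qed
  qed
  then show ?thesis by (simp add: bij_betw_same_card)
qed

text \<open>For a bijection \<open>H\<close> the kernel is the diagonal, which every relation
  contains, so the pull-back count applies to all relations.\<close>

lemma card_signed_equivs_cong: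
  assumes "\<And>a. a \<in> X \<Longrightarrow> a > 0" "\<And>a. a \<in> Y \<Longrightarrow> a > 0" "finite X" "finite Y" "card X = card Y"
  shows "card (signed_equivs X) = card (signed_equivs Y)"
proof -
  obtain H where H: "bij_betw H X Y"
    using assms finite_same_card_bij by blast
  then have "{r \<in> signed_equivs X. \<forall>a\<in>X. \<forall>b\<in>X. H a = H b \<longrightarrow> (a, b) \<in> r} = signed_equivs X"
    by (auto simp: bij_betw_def inj_on_eq_iff intro!: signed_equivsD(3) simp: pm_def)
  then show ?thesis
    using card_signed_equivs_containing_kernel[of X Y H] assms H by (simp add: bij_betw_def)
qed

text \<open>Restriction to \<open>pm (X - S)\<close> and adjoining the diagonal of
  \<open>pm S\<close> are mutually inverse. The prescribed pairs \<open>E\<close> avoid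
  \<open>S\<close> and survive both ways.\<close>

lemma card_signed_equivs_remove_singletons:
  assumes pos: "\<And>a. a \<in> X \<Longrightarrow> a > 0" and "S \<subseteq> X" and E: "E \<subseteq> (X - S) \<times> (X - S)"
  shows "card {r \<in> signed_equivs X. (\<forall>i\<in>S. \<forall>b. (i, b) \<in> r \<longrightarrow> b = i) \<and> E \<subseteq> r} =
    card {r \<in> signed_equivs (X - S). E \<subseteq> r}"
proof -
  let ?Y = "pm (X - S)"
  let ?A = "{r \<in> signed_equivs X. (\<forall>i\<in>S. \<forall>b. (i, b) \<in> r \<longrightarrow> b = i) \<and> E \<subseteq> r}"
  let ?B = "{r \<in> signed_equivs (X - S). E \<subseteq> r}"
  have pmX: "pm X = ?Y \<union> pm S" using \<open>S \<subseteq> X\<close> by (auto simp: pm_def)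
  \<comment> \<open>Positivity excludes that \<open>i\<close> lies in \<open>S\<close> while
    \<open>- i\<close> lies in \<open>X - S\<close>.\<close>
  have disj: "a \<notin> pm S" if "a \<in> ?Y" for a
    using that pos \<open>S \<subseteq> X\<close> unfolding pm_def by (auto; smt (verit) subsetD)
  \<comment> \<open>The adjoined diagonal must contain no pair \<open>(a, - a)\<close>, which it
    would at \<open>a = 0\<close>.\<close>
  have zero: "a \<noteq> 0" if "a \<in> pm X" for a
    using that pos unfolding pm_def by (auto; smt (verit))
  \<comment> \<open>Negation carries the singleton condition from \<open>S\<close> to its
    negatives.\<close>
  have sing: "a = b" if r: "r \<in> ?A" and "(a, b) \<in> r" "a \<in> pm S" for r a b
  proof (cases "a \<in> S")
    case True
    then show ?thesis using that by blast
  next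
    case False
    then have "- a \<in> S" using that by (auto simp: pm_def)
    moreover have "(- a, - b) \<in> r" using that signed_equivsD(6) by blast
    ultimately show ?thesis using that by force
  qed
  have "bij_betw (\<lambda>r. r \<inter> ?Y \<times> ?Y) ?A ?B"
  proof (rule bij_betw_byWitness[where f' = "\<lambda>r. r \<union> Id_on (pm S)"])
    show "\<forall>r\<in>?A. r \<inter> ?Y \<times> ?Y \<union> Id_on (pm S) = r"
    proof
      fix r assume r: "r \<in> ?A"
      then have r': "r \<in> signed_equivs X" by simp
      note D = signed_equivsD[OF r']
      have "(a, b) \<in> r \<inter> ?Y \<times> ?Y \<union> Id_on (pm S)" if "(a, b) \<in> r" for a b
        using sing[OF r that] sing[OF r D(4)[OF that]] D(1,2)[OF that] pmX that by auto
      then show "r \<inter> ?Y \<times> ?Y \<union> Id_on (pm S) = r" using D(3) pmX by auto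
    qed
    show "\<forall>r\<in>?B. (r \<union> Id_on (pm S)) \<inter> ?Y \<times> ?Y = r"
      using disj by (auto dest: signed_equivsD(1,2))
    show "(\<lambda>r. r \<inter> ?Y \<times> ?Y) ` ?A \<subseteq> ?B"
    proof
      fix q assume "q \<in> (\<lambda>r. r \<inter> ?Y \<times> ?Y) ` ?A"
      then obtain r where r: "r \<in> signed_equivs X" "E \<subseteq> r" and q: "q = r \<inter> ?Y \<times> ?Y" by blast
      note D = signed_equivsD[OF r(1)]
      have "q \<in> signed_equivs (X - S)"
      proof (rule signed_equivsI)
        show "(a, c) \<in> q" if "(a, b) \<in> q" "(b, c) \<in> q" for a b c
          using that D(5) by (auto simp: q)
        show "(- a, - b) \<in> q" if "(a, b) \<in> q" for a b
          using that D(6) by (auto simp: q)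
        show "(b, a) \<in> q" if "(a, b) \<in> q" for a b
          using that D(4) by (auto simp: q)
        show "(a, a) \<in> q" if "a \<in> ?Y" for a
          using that D(3) pmX by (auto simp: q)
      qed (use D(7) in \<open>auto simp: q\<close>)
      moreover have "E \<subseteq> q" using r(2) E by (auto simp: q pm_def)
      ultimately show "q \<in> ?B" by simp
    qed
    show "(\<lambda>r. r \<union> Id_on (pm S)) ` ?B \<subseteq> ?A"
    proof
      fix q assume "q \<in> (\<lambda>r. r \<union> Id_on (pm S)) ` ?B"
      then obtain r where r: "r \<in> signed_equivs (X - S)" "E \<subseteq> r" and q: "q = r \<union> Id_on (pm S)"
        by blast
      note D = signed_equivsD[OF r(1)]
      have "q \<in> signed_equivs X"
      proof (rule signed_equivsI)
        show "(a, - a) \<notin> q" for a using D(7) zero pmX by (auto simp: q)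
        show "(a, c) \<in> q" if "(a, b) \<in> q" "(b, c) \<in> q" for a b c
          using that D(5) by (auto simp: q)
        show "(- a, - b) \<in> q" if "(a, b) \<in> q" for a b
          using that D(6) by (auto simp: q)
        show "(b, a) \<in> q" if "(a, b) \<in> q" for a b
          using that D(4) by (auto simp: q)
        show "(a, a) \<in> q" if "a \<in> pm X" for a
          using that D(3) pmX by (auto simp: q)
        show "q \<subseteq> pm X \<times> pm X"
          using D(1,2) pmX by (auto simp: q)
      qed
      moreover have "b = i" if "i \<in> S" "(i, b) \<in> q" for i b
        using that D(1) disj by (auto simp: q pm_def)
      ultimately show "q \<in> ?A" using r(2) q by blast
    qed
  qed
  then show ?thesis by (rule bij_betw_same_card)
qed


section \<open>The successor map of the cycle\<close>

lemma cyc_succ_mem: "j \<in> {1..int n} \<Longrightarrow> cyc_succ n j \<in> {1..int n}"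
  by (auto simp: cyc_succ_def)

lemma inj_on_cyc_succ: "inj_on (cyc_succ n) {1..int n}"
  by (auto simp: inj_on_def cyc_succ_def split: if_splits)

lemma cyc_succ_image: "cyc_succ n ` {1..int n} = {1..int n}"
  by (rule endo_inj_surj) (auto simp: inj_on_cyc_succ intro!: cyc_succ_mem)

text \<open>From any element of \<open>B\<close> one climbs to \<open>int n\<close>, wraps around to
  1, and climbs through everything.\<close>

lemma cyc_succ_closed_eq:
  assumes "B \<subseteq> {1..int n}" "cyc_succ n ` B \<subseteq> B" "B \<noteq> {}"
  shows "B = {1..int n}"
proof -
  have up: "i \<in> B" if j: "j \<in> B" and i: "j \<le> i" "i \<le> int n" for i j
    using i
  proof (induction i rule: int_ge_induct)
    case (step i)
    then have "cyc_succ n i \<in> B" "i \<noteq> int n" using assms(2) by auto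
    then show ?case by (simp add: cyc_succ_def)
  qed (use j in simp)
  obtain j where j: "j \<in> B" using assms(3) by blast
  then have "int n \<in> B" using assms(1) by (intro up[OF j]) auto
  then have "cyc_succ n (int n) \<in> B" using assms(2) by blast
  then have "1 \<in> B" by (simp add: cyc_succ_def)
  then show ?thesis using up assms(1) by force
qed

section \<open>Counting relations with prescribed singletons and adjacencies\<close>

definition singles :: "nat \<Rightarrow> int rel \<Rightarrow> int set" where
  "singles n r = {i \<in> {1..int n}. \<forall>b. (i, b) \<in> r \<longrightarrow> b = i}"

definition adjacents :: "nat \<Rightarrow> int rel \<Rightarrow> int set" where
  "adjacents n r = {j \<in> {1..int n}. (j, cyc_succ n j) \<in> r}"

text \<open>Inclusions rather than equalities: these are the superset counts that
  inclusion-exclusion needs.\<close>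

definition forced :: "nat \<Rightarrow> int set \<Rightarrow> int set \<Rightarrow> int rel set" where
  "forced n S A = {r \<in> signed_equivs {1..int n}. S \<subseteq> singles n r \<and> A \<subseteq> adjacents n r}"

text \<open>Every element is contracted along the cycle to the first successor outside \<open>A\<close>.\<close>

lemma card_forced_compatible:
  assumes S: "S \<subseteq> {1..int n}" and A: "A \<subseteq> {1..int n}" "A \<noteq> {1..int n}"
    and compat: "\<And>j. j \<in> A \<Longrightarrow> j \<notin> S \<and> cyc_succ n j \<notin> S"
  shows "card (forced n S A) = card (signed_equivs {1..int (n - card S - card A)})"
proof -
  let ?s = "cyc_succ n"
  define X where "X = {1..int n} - S"
  define E where "E = (\<lambda>j. (j, ?s j)) ` A"
  define P where "P j k \<longleftrightarrow> (?s ^^ k) j \<notin> A" for j k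
  define H where "H j = (?s ^^ (LEAST k. P j k)) j" for j
  have sAX: "?s j \<in> X" if "j \<in> A" for j
    using A compat that cyc_succ_mem[of j n] by (auto simp: X_def)
  have AX: "A \<subseteq> X" using A compat by (auto simp: X_def)
  \<comment> \<open>An orbit that never leaves \<open>A\<close> is closed under the successor, hence
    the whole cycle, against \<open>A \<noteq> {1..int n}\<close>.\<close>
  have ex: "\<exists>k. P j k" if "j \<in> X" for j
  proof (rule ccontr)
    assume "\<not> (\<exists>k. P j k)"
    then have orbit: "(?s ^^ k) j \<in> A" for k by (simp add: P_def)
    let ?B = "range (\<lambda>k. (?s ^^ k) j)"
    have "?s ((?s ^^ k) j) \<in> ?B" for k
      by (rule range_eqI[of _ _ "Suc k"]) simp
    then have closed: "?s ` ?B \<subseteq> ?B" by blast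
    have "?B \<subseteq> A" using orbit by (rule image_subsetI)
    then have "?B = {1..int n}"
      using A(1) closed by (intro cyc_succ_closed_eq) simp_all
    then show False using \<open>?B \<subseteq> A\<close> A by simp
  qed
  have H_out: "H j \<notin> A" if "j \<in> X" for j
    using LeastI_ex[OF ex[OF that]] by (simp add: P_def H_def)
  have H_fix: "H j = j" if "j \<notin> A" for j
  proof -
    have "(LEAST k. P j k) = 0" using that by (intro Least_equality) (auto simp: P_def)
    then show ?thesis by (simp add: H_def)
  qed
  \<comment> \<open>From \<open>j\<close> in \<open>A\<close> the walk needs one step more than from
    its successor and ends at the same place.\<close>
  have H_step: "H j = H (?s j)" if "j \<in> A" for j
  proof -
    have "j \<in> X" using that AX by blast
    then obtain k where "P j k" using ex by blast
    moreover have "\<not> P j 0" using that by (simp add: P_def)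
    ultimately have "(LEAST k. P j k) = Suc (LEAST k. P j (Suc k))"
      by (rule Least_Suc)
    moreover have "P j (Suc k) = P (?s j) k" for k
      by (simp add: P_def funpow_swap1)
    ultimately show ?thesis by (simp add: H_def funpow_swap1)
  qed
  \<comment> \<open>All points before the end of the walk lie in \<open>A\<close>, so each step is a
    pair of \<open>E\<close>, and transitivity joins \<open>j\<close> to \<open>H j\<close>.\<close>
  have H_path: "(j, H j) \<in> r" if r: "r \<in> signed_equivs X" "E \<subseteq> r" and j: "j \<in> X" for r j
  proof -
    have "(j, (?s ^^ k) j) \<in> r" if "k \<le> (LEAST k. P j k)" for k
      using that
    proof (induction k)
      case 0
      then show ?case using signed_equivsD(3)[OF r(1)] j by (simp add: pm_def)
    next
      case (Suc k)
      then have "(?s ^^ k) j \<in> A" using not_less_Least[of k "P j"] by (simp add: P_def)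
      then have "((?s ^^ k) j, ?s ((?s ^^ k) j)) \<in> r" using r(2) by (auto simp: E_def)
      then show ?case using Suc signed_equivsD(5)[OF r(1)] by simp
    qed
    then show ?thesis by (simp add: H_def)
  qed
  have H_mem: "H j \<in> X" if "j \<in> X" for j
  proof -
    have "(?s ^^ k) j \<in> X" if "k \<le> (LEAST k. P j k)" for k
      using that
    proof (induction k)
      case (Suc k)
      then have "(?s ^^ k) j \<in> A" using not_less_Least[of k "P j"] by (simp add: P_def)
      then show ?case using sAX by simp
    qed (use \<open>j \<in> X\<close> in simp)
    then show ?thesis by (simp add: H_def)
  qed
  \<comment> \<open>\<open>H\<close> is a retraction of \<open>X\<close> onto \<open>X - A\<close>,
    so contraction leaves one pair for each element of \<open>X - A\<close>.\<close>
  have HX: "H ` X = X - A"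
  proof
    show "H ` X \<subseteq> X - A" using H_mem H_out by blast
    show "X - A \<subseteq> H ` X" using H_fix by force
  qed
  \<comment> \<open>Turns the adjacency condition into containment of the kernel of
    \<open>H\<close>, the form in which pulling back applies: elements with a common endpoint are
    joined through it, and conversely \<open>j\<close> in \<open>A\<close> shares its endpoint with
    its successor.\<close>
  have kernel: "E \<subseteq> r \<longleftrightarrow> (\<forall>a\<in>X. \<forall>b\<in>X. H a = H b \<longrightarrow> (a, b) \<in> r)"
    if r: "r \<in> signed_equivs X" for r
  proof
    assume "E \<subseteq> r"
    then have "(a, b) \<in> r" if "a \<in> X" "b \<in> X" "H a = H b" for a b
      using H_path[OF r] signed_equivsD(4,5)[OF r] that by metis
    then show "\<forall>a\<in>X. \<forall>b\<in>X. H a = H b \<longrightarrow> (a, b) \<in> r" by blast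
  next
    assume R: "\<forall>a\<in>X. \<forall>b\<in>X. H a = H b \<longrightarrow> (a, b) \<in> r"
    have "(j, ?s j) \<in> r" if "j \<in> A" for j
      using R H_step[OF that] sAX[OF that] AX that by blast
    then show "E \<subseteq> r" by (auto simp: E_def)
  qed
  have "forced n S A =
      {r \<in> signed_equivs {1..int n}. (\<forall>i\<in>S. \<forall>b. (i, b) \<in> r \<longrightarrow> b = i) \<and> E \<subseteq> r}"
    using S A by (force simp: forced_def singles_def adjacents_def E_def)
  also have "card \<dots> = card {r \<in> signed_equivs X. E \<subseteq> r}"
    unfolding X_def using S AX sAX
    by (intro card_signed_equivs_remove_singletons) (auto simp: E_def X_def)
  also have "{r \<in> signed_equivs X. E \<subseteq> r} =
      {r \<in> signed_equivs X. \<forall>a\<in>X. \<forall>b\<in>X. H a = H b \<longrightarrow> (a, b) \<in> r}"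
    using kernel by blast
  also have "card \<dots> = card (signed_equivs (X - A))"
    by (rule card_signed_equivs_containing_kernel) (auto simp: HX, auto simp: X_def)
  also have "\<dots> = card (signed_equivs {1..int (n - card S - card A)})"
  proof (rule card_signed_equivs_cong)
    have "finite S" "finite A" using S A by (auto intro: finite_subset)
    \<comment> \<open>\<open>A\<close> lies in the complement of \<open>S\<close>, so the
      subtractions on natural numbers do not truncate.\<close>
    then show "card (X - A) = card {1..int (n - card S - card A)}"
      using S AX by (simp add: card_Diff_subset X_def)
  qed (auto simp: X_def)
  finally show ?thesis .
qed

section \<open>The extreme cases: all adjacencies or all singletons\<close>

lemma card_signed_equivs_empty: "card (signed_equivs {}) = 1"
proof -
  have "{} \<in> signed_equivs {}"
    by (rule signed_equivsI) (auto simp: pm_def)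
  moreover have "r = {}" if "r \<in> signed_equivs {}" for r
    using signed_equivsD(1)[OF that] by (auto simp: pm_def)
  ultimately have "signed_equivs {} = {{}}" by blast
  then show ?thesis by simp
qed

lemma card_signed_equivs_1: "card (signed_equivs {1}) = 1"
proof -
  have "{(1, 1), (- 1, - 1)} \<in> signed_equivs {1}"
    by (rule signed_equivsI) (auto simp: pm_def)
  moreover have "r = {(1, 1), (- 1, - 1)}" if "r \<in> signed_equivs {1}" for r
  proof -
    note D = signed_equivsD[OF that]
    have "(1, 1) \<in> r" "(- 1, - 1) \<in> r" using D(3) by (auto simp: pm_def)
    moreover have "(1, - 1) \<notin> r" "(- 1, 1) \<notin> r" using D(7)[of 1] D(7)[of "- 1"] by auto
    moreover have "r \<subseteq> {1, - 1} \<times> {1, - 1}" using D(1,2) by (auto simp: pm_def)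
    ultimately show ?thesis by auto
  qed
  ultimately have "signed_equivs {1} = {{(1, 1), (- 1, - 1)}}" by blast
  then show ?thesis by simp
qed

text \<open>Contraction needs an element outside \<open>A\<close>, so one edge is dropped first. The
  remaining \<open>n - 1\<close> adjacencies leave one pair, which carries exactly one
  relation.\<close>

lemma card_forced_all_adjacent:
  assumes "n \<ge> 1"
  shows "card (forced n {} {1..int n}) = 1"
proof -
  \<comment> \<open>The last adjacency follows from the others by transitivity.\<close>
  let ?A = "{1..int n} - {int n}"
  have "(1, i) \<in> r" if r: "r \<in> forced n {} ?A" and i: "1 \<le> i" "i \<le> int n" for r i
    using i
  proof (induction i rule: int_ge_induct)
    case base
    then show ?case
      using r signed_equivsD(3)[of r "{1..int n}"] by (auto simp: forced_def pm_def)
  next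
    case (step i)
    then have "(i, i + 1) \<in> r"
      using r by (force simp: forced_def adjacents_def cyc_succ_def)
    moreover have "(1, i) \<in> r" using step by simp
    ultimately show ?case
      using r signed_equivsD(5)[of r "{1..int n}"] unfolding forced_def by blast
  qed
  then have "(int n, 1) \<in> r" if "r \<in> forced n {} ?A" for r
    using that assms signed_equivsD(4)[of r "{1..int n}"] by (auto simp: forced_def)
  then have "int n \<in> adjacents n r" if "r \<in> forced n {} ?A" for r
    using that assms by (simp add: adjacents_def cyc_succ_def)
  then have "forced n {} ?A = forced n {} {1..int n}"
    unfolding forced_def by blast
  moreover have "card (forced n {} ?A) = card (signed_equivs {1..int (n - card ({} :: int set) - card ?A)})"
  proof (rule card_forced_compatible)
    show "?A \<noteq> {1..int n}" using assms by (metis Diff_iff atLeastAtMost_iff insertI1 of_nat_1 of_nat_le_iff order_refl)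
  qed auto
  moreover have "n - card ({} :: int set) - card ?A = 1"
    using assms by simp
  ultimately show ?thesis by (simp add: card_signed_equivs_1)
qed

text \<open>Deleting everything leaves the empty ground set. Since \<open>n \<ge> 1\<close>, the
  empty adjacency set is not the whole cycle, as the compatible count requires.\<close>

lemma card_forced_all_singles:
  assumes "n \<ge> 1"
  shows "card (forced n {1..int n} {}) = 1"
proof -
  have "card (forced n {1..int n} {}) =
      card (signed_equivs {1..int (n - card {1..int n} - card ({} :: int set))})"
    using assms by (intro card_forced_compatible) auto
  then show ?thesis by (simp add: card_signed_equivs_empty)
qed

section \<open>Duality between vertices and edges of the cycle\<close>

text \<open>Sending the vertex \<open>i\<close> of the cycle to the edge \<open>(i, i + 1)\<close>, and the edge
  \<open>(i, i + 1)\<close> to the vertex \<open>i + 1\<close>, preserves incidence.\<close>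

lemma card_forced_dual:
  assumes "n \<ge> 2" and S: "S \<subseteq> {1..int n}" and A: "A \<subseteq> {1..int n}"
  shows "card (forced n S A) = card (forced n (cyc_succ n ` A) S)"
proof (cases "\<exists>j\<in>A. j \<in> S \<or> cyc_succ n j \<in> S")
  case True
  let ?s = "cyc_succ n"
  \<comment> \<open>For \<open>n \<ge> 2\<close> no edge is a loop, so an adjacency rules out
    singletons at both of its ends. Both counts therefore vanish as soon as some edge of
    \<open>A\<close> meets \<open>S\<close>.\<close>
  have neq: "?s j \<noteq> j" for j using \<open>n \<ge> 2\<close> by (auto simp: cyc_succ_def)
  obtain j where j: "j \<in> A" "j \<in> S \<or> ?s j \<in> S" using True by blast
  have "r \<notin> forced n S A" for r
  proof
    assume r: "r \<in> forced n S A"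
    then have "(j, ?s j) \<in> r" "(?s j, j) \<in> r"
      using j signed_equivsD(4)[of r "{1..int n}"] by (auto simp: forced_def adjacents_def)
    then show False using r j(2) neq[of j] by (fastforce simp: forced_def singles_def)
  qed
  moreover have "r \<notin> forced n (?s ` A) S" for r
  proof
    assume r: "r \<in> forced n (?s ` A) S"
    then have single: "b = ?s j" if "(?s j, b) \<in> r" for b
      using j(1) that by (auto simp: forced_def singles_def)
    \<comment> \<open>On the dual side the singleton \<open>?s j\<close> is the second end of the
      edge \<open>j\<close> and the first end of the edge \<open>?s j\<close>; one of these edges is
      prescribed.\<close>
    from j(2) show False
    proof
      assume "j \<in> S"
      then have "(?s j, j) \<in> r"
        using r signed_equivsD(4)[of r "{1..int n}"] by (auto simp: forced_def adjacents_def)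
      then show False using single neq[of j] by metis
    next
      assume "?s j \<in> S"
      then have "(?s j, ?s (?s j)) \<in> r" using r by (auto simp: forced_def adjacents_def)
      then show False using single neq[of "?s j"] by metis
    qed
  qed
  ultimately have "forced n S A = {}" "forced n (?s ` A) S = {}" by blast+
  then show ?thesis by simp
next
  case compat: False
  let ?s = "cyc_succ n"
  have sA: "?s ` A \<subseteq> {1..int n}" using A cyc_succ_mem by blast
  have card_sA: "card (?s ` A) = card A"
    using inj_on_subset[OF inj_on_cyc_succ A] by (rule card_image)
  \<comment> \<open>The compatible count needs a proper adjacency set on either side, and that set
    is \<open>A\<close> on one and \<open>S\<close> on the other. If one of them is full,
    compatibility makes the other empty.\<close>
  consider "A = {1..int n}" | "S = {1..int n}" | "A \<noteq> {1..int n}" "S \<noteq> {1..int n}" by blast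
  then show ?thesis
  proof cases
    case 1
    then have "S = {}" using compat S by blast
    then show ?thesis
      using 1 assms(1) by (simp add: cyc_succ_image card_forced_all_adjacent card_forced_all_singles)
  next
    case 2
    then have "A = {}" using compat A by blast
    then show ?thesis
      using 2 assms(1) by (simp add: card_forced_all_adjacent card_forced_all_singles)
  next
    case 3
    have "card (forced n S A) = card (signed_equivs {1..int (n - card S - card A)})"
      using S A 3 compat by (intro card_forced_compatible) auto
    moreover have "card (forced n (?s ` A) S) =
        card (signed_equivs {1..int (n - card (?s ` A) - card S)})"
    proof (rule card_forced_compatible[OF sA S 3(2)])
      fix j assume j: "j \<in> S"
      \<comment> \<open>By injectivity, \<open>?s j\<close> in the image of \<open>A\<close> would
        mean that the vertex \<open>j\<close> of \<open>S\<close> is itself an edge of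
        \<open>A\<close>, which compatibility forbids.\<close>
      have "?s j \<notin> ?s ` A"
        using j S A compat inj_on_image_mem_iff[OF inj_on_cyc_succ, of j n A] by blast
      then show "j \<notin> ?s ` A \<and> ?s j \<notin> ?s ` A" using j compat by blast
    qed
    ultimately show ?thesis by (simp add: card_sA add.commute)
  qed
qed

lemma sum_singles_adjacents_commute:
  fixes h :: "nat \<Rightarrow> nat \<Rightarrow> 'c::comm_semiring_1"
  assumes "n \<ge> 2"
  shows "(\<Sum>r\<in>signed_equivs {1..int n}. h (card (singles n r)) (card (adjacents n r))) =
    (\<Sum>r\<in>signed_equivs {1..int n}. h (card (adjacents n r)) (card (singles n r)))"
proof -
  let ?N = "{1..int n}" and ?s = "cyc_succ n"
  \<comment> \<open>A set of vertices and a set of edges are stored together as one subset of a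
    disjoint sum, so that inclusion-exclusion handles both statistics at once.\<close>
  define k where "k T = h (card (Inl -` T)) (card (Inr -` T))" for T :: "(int + int) set"
  define f where "f r = singles n r <+> adjacents n r" for r
  \<comment> \<open>The dual of \<open>f\<close>: the vertex slot holds the adjacencies, and the
    edge slot holds each singleton moved back by one. The shift makes inclusion in
    \<open>g r\<close> match the dual count.\<close>
  define g where "g r = adjacents n r <+> {j \<in> ?N. ?s j \<in> singles n r}" for r
  have vimage_Plus: "Inl -` (B <+> C) = B" "Inr -` (B <+> C) = C" for B C :: "int set"
    by auto
  have sub: "singles n r \<subseteq> ?N" "adjacents n r \<subseteq> ?N" for r
    by (auto simp: singles_def adjacents_def)
  have "(\<Sum>r\<in>signed_equivs ?N. k (f r)) = (\<Sum>r\<in>signed_equivs ?N. k (g r))"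
  proof (rule sum_eq_if_card_supersets_eq[where U = "?N <+> ?N"])
    show "finite (signed_equivs ?N)" by (simp add: finite_signed_equivs)
    show "f r \<subseteq> ?N <+> ?N" "g r \<subseteq> ?N <+> ?N" for r
      using sub by (auto simp: f_def g_def)
    fix T assume T: "T \<subseteq> ?N <+> ?N"
    let ?S = "Inl -` T" and ?A = "Inr -` T"
    have SA: "?S \<subseteq> ?N" "?A \<subseteq> ?N" using T by auto
    have Plus_iff: "T \<subseteq> B <+> C \<longleftrightarrow> ?S \<subseteq> B \<and> ?A \<subseteq> C" for B C
    proof
      assume R: "?S \<subseteq> B \<and> ?A \<subseteq> C"
      show "T \<subseteq> B <+> C"
      proof
        fix t assume "t \<in> T"
        then show "t \<in> B <+> C" using R by (cases t) auto
      qed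
    qed auto
    have "{r \<in> signed_equivs ?N. T \<subseteq> f r} = forced n ?S ?A"
      by (simp add: f_def Plus_iff forced_def)
    moreover have "{r \<in> signed_equivs ?N. T \<subseteq> g r} = forced n (?s ` ?A) ?S"
      using SA(2) by (auto simp: g_def Plus_iff forced_def)
    ultimately show "card {r \<in> signed_equivs ?N. T \<subseteq> f r} = card {r \<in> signed_equivs ?N. T \<subseteq> g r}"
      using card_forced_dual[OF assms SA] by simp
  qed simp
  \<comment> \<open>The shift is a bijection of the cycle, so it does not affect the cardinality
    that enters \<open>k\<close>.\<close>
  moreover have "card {j \<in> ?N. ?s j \<in> singles n r} = card (singles n r)" for r
  proof -
    have "singles n r \<subseteq> ?s ` ?N" using sub(1) by (simp add: cyc_succ_image)
    then have "?s ` {j \<in> ?N. ?s j \<in> singles n r} = singles n r" by blast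
    moreover have "inj_on ?s {j \<in> ?N. ?s j \<in> singles n r}"
      by (rule inj_on_subset[OF inj_on_cyc_succ]) auto
    ultimately show ?thesis using card_image by metis
  qed
  ultimately show ?thesis
    by (simp add: k_def f_def g_def vimage_Plus)
qed

section \<open>Translation between partitions and relations\<close>

lemma pm_atLeastAtMost: "pm {1..int n} = pm_set n"
proof -
  have "uminus ` {1..int n} = {- int n..- 1}" by simp
  then show ?thesis by (auto simp: pm_def pm_set_def)
qed

definition same_block :: "int set set \<Rightarrow> int rel" where
  "same_block \<pi> = {(x, y). \<exists>B\<in>\<pi>. x \<in> B \<and> y \<in> B}"

lemma partition_on_unique_block:
  assumes "partition_on X \<pi>" "B \<in> \<pi>" "C \<in> \<pi>" "x \<in> B" "x \<in> C"
  shows "B = C"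
proof (rule ccontr)
  assume "B \<noteq> C"
  then have "B \<inter> C = {}"
    by (rule disjointD[OF partition_onD2[OF assms(1)] assms(2,3)])
  then show False using assms(4,5) by blast
qed

text \<open>Refines the correspondence between partitions and equivalence relations, with the
  quotient as inverse: closure of the blocks under negation matches invariance of the relation, and
  having no zero-block matches the absence of pairs \<open>(a, - a)\<close>.\<close>

lemma bij_betw_same_block: "bij_betw same_block (V n) (signed_equivs {1..int n})"
proof (rule bij_betw_byWitness[where f' = "\<lambda>r. pm_set n // r"])
  show "\<forall>\<pi>\<in>V n. pm_set n // same_block \<pi> = \<pi>"
    unfolding same_block_def by (auto simp: V_def typeB_partitions_def partition_on_eq_quotient)
  have quot: "same_block (pm_set n // r) = r" if "equiv (pm_set n) r" for r
  proof -
    have "(x, y) \<in> r" if xy: "(x, y) \<in> same_block (pm_set n // r)" for x y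
    proof -
      obtain B where "B \<in> pm_set n // r" "x \<in> B" "y \<in> B" using xy by (auto simp: same_block_def)
      then show ?thesis using \<open>equiv (pm_set n) r\<close> by (meson in_quotient_imp_closed quotient_eq_iff)
    qed
    moreover have "(x, y) \<in> same_block (pm_set n // r)" if xy: "(x, y) \<in> r" for x y
    proof -
      have "x \<in> pm_set n" "x \<in> r `` {x}" "y \<in> r `` {x}"
        using \<open>equiv (pm_set n) r\<close> xy equiv_class_self equiv_class_eq_iff by fastforce+
      then show ?thesis unfolding same_block_def by (auto intro: quotientI)
    qed
    ultimately show ?thesis by auto
  qed
  have equiv_if: "equiv (pm_set n) r" if "r \<in> signed_equivs {1..int n}" for r
    using that by (simp add: signed_equivs_def pm_atLeastAtMost)
  show "\<forall>r\<in>signed_equivs {1..int n}. same_block (pm_set n // r) = r"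
    using quot equiv_if by blast
  show "same_block ` V n \<subseteq> signed_equivs {1..int n}"
  proof
    fix r assume "r \<in> same_block ` V n"
    then obtain \<pi> where \<pi>: "\<pi> \<in> V n" and r: "r = same_block \<pi>" by blast
    have part: "partition_on (pm_set n) \<pi>" and neg: "\<And>B. B \<in> \<pi> \<Longrightarrow> uminus ` B \<in> \<pi>"
      and nz: "\<And>B. B \<in> \<pi> \<Longrightarrow> uminus ` B \<noteq> B"
      using \<pi> unfolding V_def typeB_partitions_def zero_block_def by blast+
    have "equiv (pm {1..int n}) r"
      using equiv_partition_on[OF part] by (simp add: r same_block_def pm_atLeastAtMost)
    moreover have "(- a, - b) \<in> r" if ab: "(a, b) \<in> r" for a b
    proof -
      obtain B where "B \<in> \<pi>" "a \<in> B" "b \<in> B" using ab by (auto simp: r same_block_def)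
      then show ?thesis using neg unfolding r same_block_def by blast
    qed
    moreover have "(a, - a) \<notin> r" for a
    proof
      assume "(a, - a) \<in> r"
      then obtain B where B: "B \<in> \<pi>" "a \<in> B" "- a \<in> B" by (auto simp: r same_block_def)
      \<comment> \<open>\<open>B\<close> and its negative are blocks sharing \<open>a\<close>, hence
        equal, which makes \<open>B\<close> a zero-block.\<close>
      then have "a \<in> uminus ` B" using image_eqI[of a uminus "- a" B] by simp
      then have "uminus ` B = B"
        using partition_on_unique_block[OF part] neg B by blast
      then show False using nz B by blast
    qed
    ultimately show "r \<in> signed_equivs {1..int n}" by (simp add: signed_equivs_def)
  qed
  show "(\<lambda>r. pm_set n // r) ` signed_equivs {1..int n} \<subseteq> V n"
  proof
    fix \<pi> assume "\<pi> \<in> (\<lambda>r. pm_set n // r) ` signed_equivs {1..int n}"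
    then obtain r where r: "r \<in> signed_equivs {1..int n}" and \<pi>: "\<pi> = pm_set n // r" by blast
    note D = signed_equivsD[OF r, unfolded pm_atLeastAtMost]
    have part: "partition_on (pm_set n) \<pi>"
      using partition_on_quotient[OF equiv_if[OF r]] \<pi> by simp
    have "uminus ` B \<in> \<pi>" if B: "B \<in> \<pi>" for B
    proof -
      obtain x where x: "x \<in> pm_set n" "B = r `` {x}" using B \<pi> by (auto elim: quotientE)
      \<comment> \<open>Negation is an involution preserving \<open>r\<close>, so it maps the class
        of \<open>x\<close> onto that of \<open>- x\<close>.\<close>
      have "uminus ` B = r `` {- x}"
      proof
        show "uminus ` B \<subseteq> r `` {- x}" using D(6) x by blast
        show "r `` {- x} \<subseteq> uminus ` B"
        proof
          fix y assume "y \<in> r `` {- x}"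
          then have "- y \<in> B" using D(6)[of "- x" y] x by simp
          then show "y \<in> uminus ` B" using image_eqI[of y uminus "- y" B] by simp
        qed
      qed
      moreover have "- x \<in> pm_set n" using x by (simp add: pm_set_def)
      ultimately show ?thesis unfolding \<pi> by (simp add: quotientI)
    qed
    moreover have "\<not> zero_block \<pi> B" for B
    proof
      assume B: "zero_block \<pi> B"
      \<comment> \<open>The empty set equals its own negative, so a contradiction needs blocks to be
        nonempty.\<close>
      then have "B \<noteq> {}" using partition_onD3[OF part] by (auto simp: zero_block_def)
      then obtain x where "x \<in> B" by blast
      then have "- x \<in> uminus ` B" by blast
      then have "- x \<in> B" using B by (simp add: zero_block_def)
      then have "(x, - x) \<in> same_block \<pi>"
        using \<open>x \<in> B\<close> B by (auto simp: zero_block_def same_block_def)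
      then show False using quot[OF equiv_if[OF r]] D(7) \<pi> by simp
    qed
    ultimately show "\<pi> \<in> V n" using part by (simp add: V_def typeB_partitions_def)
  qed
qed

lemma singleton_pairs_eq_card_singles:
  assumes "\<pi> \<in> V n"
  shows "singleton_pairs n \<pi> = card (singles n (same_block \<pi>))"
proof -
  have part: "partition_on (pm_set n) \<pi>"
    using assms by (simp add: V_def typeB_partitions_def)
  have "{i} \<in> \<pi> \<longleftrightarrow> (\<forall>b. (i, b) \<in> same_block \<pi> \<longrightarrow> b = i)" if i: "i \<in> {1..int n}" for i
  proof
    assume "{i} \<in> \<pi>"
    then show "\<forall>b. (i, b) \<in> same_block \<pi> \<longrightarrow> b = i"
      using partition_on_unique_block[OF part] by (fastforce simp: same_block_def)
  next
    assume R: "\<forall>b. (i, b) \<in> same_block \<pi> \<longrightarrow> b = i"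
    \<comment> \<open>The condition \<open>R\<close> would hold vacuously for an element in no
      block, so a block containing \<open>i\<close> is produced first.\<close>
    have "i \<in> \<Union> \<pi>" using i partition_onD1[OF part] by (auto simp: pm_set_def)
    then obtain B where "B \<in> \<pi>" "i \<in> B" by blast
    then have "B = {i}" using R by (auto simp: same_block_def)
    then show "{i} \<in> \<pi>" using \<open>B \<in> \<pi>\<close> by simp
  qed
  then have "{i \<in> {1..int n}. {i} \<in> \<pi>} = singles n (same_block \<pi>)"
    unfolding singles_def by blast
  then show ?thesis by (simp add: singleton_pairs_def)
qed

lemma adjacency_pairs_eq_card_adjacents:
  "adjacency_pairs n \<pi> = card (adjacents n (same_block \<pi>))"
  by (simp add: adjacency_pairs_def adjacents_def same_block_def)

section \<open>Symmetry of the joint distribution\<close>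

lemma singles_adjacents_1:
  assumes "r \<in> signed_equivs {1..int 1}"
  shows "singles 1 r = {1}" "adjacents 1 r = {1}"
proof -
  note D = signed_equivsD[OF assms]
  have "b = 1" if "(1, b) \<in> r" for b
    using D(2)[OF that] D(7)[of 1] that by (auto simp: pm_def)
  then show "singles 1 r = {1}" by (auto simp: singles_def)
  have "(1, 1) \<in> r" using D(3) by (simp add: pm_def)
  then show "adjacents 1 r = {1}" by (auto simp: adjacents_def cyc_succ_def)
qed

text \<open>The weight \<open>h\<close> is left arbitrary so that monomials yield the polynomial
  identity and indicator functions the equality of cardinalities.\<close>

lemma sum_V_commute:
  fixes h :: "nat \<Rightarrow> nat \<Rightarrow> 'c::comm_semiring_1"
  assumes "n \<ge> 1"
  shows "(\<Sum>\<pi>\<in>V n. h (singleton_pairs n \<pi>) (adjacency_pairs n \<pi>)) =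
    (\<Sum>\<pi>\<in>V n. h (adjacency_pairs n \<pi>) (singleton_pairs n \<pi>))"
proof -
  have transfer: "(\<Sum>\<pi>\<in>V n. k (singleton_pairs n \<pi>) (adjacency_pairs n \<pi>)) =
      (\<Sum>r\<in>signed_equivs {1..int n}. k (card (singles n r)) (card (adjacents n r)))"
    for k :: "nat \<Rightarrow> nat \<Rightarrow> 'c"
    unfolding sum.reindex_bij_betw[OF bij_betw_same_block, symmetric]
    by (simp add: singleton_pairs_eq_card_singles adjacency_pairs_eq_card_adjacents)
  have "(\<Sum>r\<in>signed_equivs {1..int n}. h (card (singles n r)) (card (adjacents n r))) =
      (\<Sum>r\<in>signed_equivs {1..int n}. h (card (adjacents n r)) (card (singles n r)))"
  proof (cases "n = 1")
    case True
    then show ?thesis using singles_adjacents_1 by (intro sum.cong) simp_all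
  next
    case False
    then show ?thesis using assms by (intro sum_singles_adjacents_commute) simp
  qed
  then show ?thesis
    using transfer[of h] transfer[of "\<lambda>i j. h j i"] by simp
qed

theorem theorem2p1:
  fixes n :: nat and x y :: "'a::comm_semiring_1"
  assumes "n \<ge> 1"
  shows "P n x y = P n y x \<and>
    (\<forall>k l. card {\<pi> \<in> V n. singleton_pairs n \<pi> = k \<and> adjacency_pairs n \<pi> = l} =
           card {\<pi> \<in> V n. singleton_pairs n \<pi> = l \<and> adjacency_pairs n \<pi> = k})"
proof (intro conjI allI)
  show "P n x y = P n y x"
    unfolding P_def using sum_V_commute[OF assms, of "\<lambda>i j. x ^ i * y ^ j"]
    by (simp add: mult.commute)
next
  fix k l
  \<comment> \<open>Cardinalities become sums of 0-1 weights, to which the symmetry of sums over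
    \<open>V n\<close> applies with values in the natural numbers.\<close>
  have card: "card {\<pi> \<in> V n. Q \<pi>} = (\<Sum>\<pi>\<in>V n. if Q \<pi> then 1 else 0)" for Q
    by (simp add: finite_V sum.If_cases Int_def)
  show "card {\<pi> \<in> V n. singleton_pairs n \<pi> = k \<and> adjacency_pairs n \<pi> = l} =
      card {\<pi> \<in> V n. singleton_pairs n \<pi> = l \<and> adjacency_pairs n \<pi> = k}"
    unfolding card
    using sum_V_commute[OF assms, of "\<lambda>i j. if i = k \<and> j = l then 1 else (0 :: nat)"]
    by (simp add: conj_commute)
qed

end
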